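(* For path graph $\mathbb{P}_n,n\neq4,7$ and for $k=0,1,2,3,...$ $$TDI(\mathbb{P}_n)=\begin{cases} 4(2k+1)(k+1) &\text{ if } n=4k+2,k\geq0\\ 8k^2+7k+2 & \text{ if } n=4k+1,k>0\\ 8k^2+15k+6 & \text{ if } n=4k+3,k=0,k>1\\ 2k(4k+1) & \text{ if } n=4k,k>1 \end{cases}$$
   Context: A total dominating set (TDS) is a vertex set $S$ such that every vertex is adjacent to a vertex of $S$; a minimal TDS (MTDS) has no proper subset that is a TDS. A vertex is compliant if some MTDS contains it; a graph is compliant if all its vertices are (paths $\mathbb{P}_n$, $n\ne 4,7$, are compliant). For a vertex $a$ of a compliant graph, $d_{td}(a)=\min\{|S| : S \text{ an MTDS containing } a\}$, and the total domination index is $TDI(\mathbb{G})=\sum_{a\in V(\mathbb{G})} d_{td}(a)$. *)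

theory Defs
  imports "Graph_Theory.Pair_Digraph" "HOL-Library.Extended_Nat"
begin

definition total_dominating_set :: "('a, 'b) pre_digraph \<Rightarrow> 'a set \<Rightarrow> bool" where
  "total_dominating_set G S \<longleftrightarrow>
     S \<subseteq> verts G \<and> (\<forall>v \<in> verts G. \<exists>u \<in> S. v \<rightarrow>\<^bsub>G\<^esub> u)"

definition minimal_total_dominating_set :: "('a, 'b) pre_digraph \<Rightarrow> 'a set \<Rightarrow> bool" where
  "minimal_total_dominating_set G S \<longleftrightarrow>
     total_dominating_set G S \<and> (\<forall>T. T \<subset> S \<longrightarrow> \<not> total_dominating_set G T)"

definition compliant_vertex :: "('a, 'b) pre_digraph \<Rightarrow> 'a \<Rightarrow> bool" where
  "compliant_vertex G a \<longleftrightarrow> (\<exists>S. minimal_total_dominating_set G S \<and> a \<in> S)"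

definition compliant_graph :: "('a, 'b) pre_digraph \<Rightarrow> bool" where
  "compliant_graph G \<longleftrightarrow> (\<forall>a \<in> verts G. compliant_vertex G a)"

text \<open>
  The minimum over an empty family is \<open>\<infinity>\<close>: \<open>d_td G a\<close> is finite exactly when \<open>a\<close> is
  compliant, and on a finite graph \<open>TDI G\<close> is finite exactly when \<open>G\<close> is compliant. A finite value therefore never arises from an undefined minimum.
\<close>

definition d_td :: "('a, 'b) pre_digraph \<Rightarrow> 'a \<Rightarrow> enat" where
  "d_td G a = (INF S \<in> {S. minimal_total_dominating_set G S \<and> a \<in> S}. enat (card S))"

definition TDI :: "('a, 'b) pre_digraph \<Rightarrow> enat" where
  "TDI G = (\<Sum>a \<in> verts G. d_td G a)"

lemma d_td_attained:
  assumes "compliant_vertex G a"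
  shows "\<exists>S. minimal_total_dominating_set G S \<and> a \<in> S \<and> d_td G a = enat (card S)"
proof -
  let ?A = "{S. minimal_total_dominating_set G S \<and> a \<in> S}"
  have "(\<lambda>S. enat (card S)) ` ?A \<noteq> {}"
    using assms by (auto simp: compliant_vertex_def)
  then obtain x where "x \<in> (\<lambda>S. enat (card S)) ` ?A"
    by blast
  then have "Inf ((\<lambda>S. enat (card S)) ` ?A) \<in> (\<lambda>S. enat (card S)) ` ?A"
    by (rule wellorder_InfI)
  then show ?thesis
    by (auto simp: d_td_def)
qed

lemma d_td_finite_iff: "d_td G a \<noteq> \<infinity> \<longleftrightarrow> compliant_vertex G a"
proof
  assume fin: "d_td G a \<noteq> \<infinity>"
  show "compliant_vertex G a"
  proof (rule ccontr)
    assume "\<not> compliant_vertex G a"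
    then have "{S. minimal_total_dominating_set G S \<and> a \<in> S} = {}"
      by (auto simp: compliant_vertex_def)
    then have "d_td G a = \<infinity>"
      by (simp only: d_td_def image_empty Inf_empty top_enat_def)
    with fin show False ..
  qed
next
  assume "compliant_vertex G a"
  then show "d_td G a \<noteq> \<infinity>"
    using d_td_attained by fastforce
qed

lemma TDI_finite_iff:
  assumes "finite (verts G)"
  shows "TDI G \<noteq> \<infinity> \<longleftrightarrow> compliant_graph G"
proof -
  have "(\<Sum>a \<in> A. f a) = \<infinity> \<longleftrightarrow> (\<exists>a \<in> A. f a = \<infinity>)" if "finite A"
    for A and f :: "'a \<Rightarrow> enat"
    using that by (induction A) (auto simp: plus_eq_infty_iff_enat)
  then show ?thesis
    using assms d_td_finite_iff[of G]
    by (auto simp: TDI_def compliant_graph_def)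
qed

text \<open>Each undirected edge is represented by its two arcs.\<close>

definition path_graph :: "nat \<Rightarrow> nat pair_pre_digraph" where
  "path_graph n =
     \<lparr> pverts = {1..n},
       parcs = {(i, j). i \<in> {1..n} \<and> j \<in> {1..n} \<and> (j = i + 1 \<or> i = j + 1)} \<rparr>"

lemma pair_graph_path_graph: "pair_graph (path_graph n)"
proof
  show "finite (parcs (path_graph n))"
    by (rule finite_subset[of _ "{1..n} \<times> {1..n}"]) (auto simp: path_graph_def)
qed (auto simp: path_graph_def symmetric_def sym_def)

end

theory Submission
  imports Defs
begin

text \<open>
  Vertices of a path that do not differ by exactly 2 have disjoint neighbourhoods, so a set of such
  vertices bounds the size of every total dominating set from below. Taking the vertices congruent
  to 1 or 2 modulo 4 gives the total domination number \<open>m\<close>. Shifting the packing past \<open>a\<close>, so that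
  no neighbourhood contains \<open>a\<close>, gives the bound \<open>m + 1\<close> for sets containing \<open>a\<close>, exactly for
  \<open>a \<equiv> 1\<close> if \<open>n = 4 * k + 1\<close>, for \<open>a \<equiv> 0\<close> if \<open>n = 4 * k + 3\<close>, and for \<open>a \<equiv> 0, 1\<close> if \<open>n = 4 * k\<close>.
  Unions of two residue classes modulo 4, corrected near the ends of the path, attain these bounds.
  Such a set \<open>S\<close> is minimal as soon as \<open>S - {a}\<close> is not total dominating: a smaller total dominating
  set would be too small or would miss \<open>a\<close>.
\<close>

section \<open>Total domination in paths and a criterion for values of \<open>d_td\<close>\<close>

abbreviation path_tds :: "nat \<Rightarrow> nat set \<Rightarrow> bool" where
  "path_tds n \<equiv> total_dominating_set (with_proj (path_graph n))"

text \<open>The ends of the path need no separate treatment: \<open>S \<subseteq> {1..n}\<close>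
  excludes both 0 and \<open>n + 1\<close>, so only genuine neighbours of \<open>v\<close>
  count.\<close>

lemma path_tds_iff:
  "path_tds n S \<longleftrightarrow> S \<subseteq> {1..n} \<and> (\<forall>v \<in> {1..n}. v + 1 \<in> S \<or> v - 1 \<in> S)"
proof -
  have adj: "v \<rightarrow>\<^bsub>with_proj (path_graph n)\<^esub> u \<longleftrightarrow>
      v \<in> {1..n} \<and> u \<in> {1..n} \<and> (u = v + 1 \<or> v = u + 1)" for u v
    by (auto simp: path_graph_def arcs_ends_def arc_to_ends_def)
  have "(\<exists>u \<in> S. v \<rightarrow>\<^bsub>with_proj (path_graph n)\<^esub> u) \<longleftrightarrow> v + 1 \<in> S \<or> v - 1 \<in> S"
    if "S \<subseteq> {1..n}" "v \<in> {1..n}" for v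
    using that unfolding adj
    by (metis One_nat_def Suc_eq_plus1 Suc_pred' add_diff_cancel_right' atLeastAtMost_iff
        less_eq_Suc_le subsetD)
  then show ?thesis
    unfolding total_dominating_set_def by (auto simp: path_graph_def)
qed

lemma total_dominating_set_mono:
  assumes "total_dominating_set G T" "T \<subseteq> S" "S \<subseteq> verts G"
  shows "total_dominating_set G S"
  using assms unfolding total_dominating_set_def by blast

lemma d_td_eqI:
  assumes fin: "finite (verts G)"
    and S: "total_dominating_set G S" "a \<in> S" "card S = m"
    and priv: "\<not> total_dominating_set G (S - {a})"
    and low: "\<And>T. total_dominating_set G T \<Longrightarrow> a \<in> T \<Longrightarrow> m \<le> card T"
  shows "d_td G a = enat m"
proof -
  have sub: "S \<subseteq> verts G"
    using S(1) by (simp add: total_dominating_set_def)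
  have "\<not> total_dominating_set G T" if "T \<subset> S" for T
  proof
    assume T: "total_dominating_set G T"
    show False
    proof (cases "a \<in> T")
      case True
      moreover have "card T < card S"
        using that sub fin by (meson finite_subset psubset_card_mono)
      ultimately show False
        using low[OF T] S(3) by simp
    next
      case False
      then show False
        using that priv T sub total_dominating_set_mono[of G T "S - {a}"] by blast
    qed
  qed
  then have "minimal_total_dominating_set G S"
    using S(1) by (simp add: minimal_total_dominating_set_def)
  then have "d_td G a \<le> enat m"
    unfolding d_td_def using S(2,3) by (auto intro: INF_lower2)
  moreover have "enat m \<le> d_td G a"
    unfolding d_td_def using low
    by (auto intro!: INF_greatest simp: minimal_total_dominating_set_def)
  ultimately show ?thesis
    by (rule antisym)
qed

section \<open>Lower bounds from packings\<close>

text \<open>Each vertex of \<open>P\<close> chooses a neighbour in \<open>T\<close>, and only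
  vertices at distance 2 could choose the same one. Excluding 0 matters because truncation makes
  \<open>0 - 1\<close> equal to \<open>1 - 1\<close>.\<close>

lemma card_ge_packing:
  fixes P T :: "nat set"
  assumes "finite T"
    and meet: "\<And>v. v \<in> P \<Longrightarrow> v + 1 \<in> T \<or> v - 1 \<in> T"
    and pos: "0 \<notin> P"
    and sep: "\<And>v. v \<in> P \<Longrightarrow> v + 2 \<notin> P"
  shows "card P \<le> card T"
proof -
  define g where "g v = (if v + 1 \<in> T then v + 1 else v - 1)" for v
  have "inj_on g P"
  proof (rule inj_onI)
    fix v w assume vw: "v \<in> P" "w \<in> P" "g v = g w"
    then have "v \<noteq> 0" "w \<noteq> 0"
      using pos by metis+
    then have "v = w \<or> w = v + 2 \<or> v = w + 2"
      using vw(3) by (auto simp: g_def split: if_splits)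
    then show "v = w"
      using vw(1,2) sep by blast
  qed
  moreover have "g ` P \<subseteq> T"
    using meet by (auto simp: g_def)
  ultimately show ?thesis
    using assms(1) by (rule card_inj_on_le)
qed

text \<open>
  The odd members of the packing have the neighbourhoods \<open>{4 * i, 4 * i + 2}\<close> for \<open>i < s\<close> and
  \<open>{4 * i + 2, 4 * i + 4}\<close> for \<open>i \<ge> s\<close>, which skip only \<open>4 * s\<close>; the even ones likewise skip
  only \<open>4 * t + 1\<close>.
\<close>

lemma card_path_tds_ge:
  assumes T: "path_tds n T" and A: "A \<subseteq> T" "A \<subseteq> {4 * s, 4 * t + 1}"
    and odd: "4 * p \<le> n + 1 \<or> p \<le> s \<and> 4 * p \<le> n + 3"
    and even: "4 * q \<le> n \<or> q \<le> t \<and> 4 * q \<le> n + 2"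
  shows "p + q + card A \<le> card T"
proof -
  define f where "f i = (if i < s then 4 * i + 1 else 4 * i + 3)" for i
  define g where "g i = (if i < t then 4 * i + 2 else 4 * i + 4)" for i
  let ?P = "f ` {..<p} \<union> g ` {..<q}"
  have fT: "finite T"
    using T by (meson path_tds_iff finite_atLeastAtMost finite_subset)
  have "odd (f i)" "even (g j)" for i j
    by (simp_all add: f_def g_def)
  then have fg: "f i \<noteq> g j" "f i + 2 \<noteq> g j" "g j + 2 \<noteq> f i" for i j
    by (metis even_add even_numeral)+
  \<comment> \<open>Consecutive values of \<open>f\<close> differ by 4, except for one step of 6 at
    \<open>s\<close>; likewise those of \<open>g\<close> at \<open>t\<close>.\<close>
  have ff: "f i + 2 \<noteq> f j" for i j
    by (auto simp: f_def; presburger)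
  have gg: "g i + 2 \<noteq> g j" for i j
    by (auto simp: g_def; presburger)
  have "inj f" "inj g"
    by (auto simp: inj_def f_def g_def split: if_splits; presburger)+
  then have "card (f ` {..<p}) = p" "card (g ` {..<q}) = q"
    by (simp_all add: card_image inj_on_subset[OF _ subset_UNIV])
  moreover have "f ` {..<p} \<inter> g ` {..<q} = {}"
    by (auto simp: fg(1))
  ultimately have "card ?P = p + q"
    by (simp add: card_Un_disjoint)
  \<comment> \<open>No member of the packing is adjacent to an element of \<open>A\<close>, so
    \<open>T - A\<close> still meets all their neighbourhoods. This gains the summand
    \<open>card A\<close>.\<close>
  moreover have "card ?P \<le> card (T - A)"
  proof (rule card_ge_packing)
    fix v assume "v \<in> ?P"
    \<comment> \<open>The largest odd member is \<open>4 * p - 3\<close> if \<open>p \<le> s\<close>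
      and \<open>4 * p - 1\<close> otherwise, whence the two alternatives in \<open>odd\<close>;
      \<open>even\<close> is analogous.\<close>
    moreover have "f i \<in> {1..n}" if "i < p" for i
      using odd that by (auto simp: f_def)
    moreover have "g i \<in> {1..n}" if "i < q" for i
      using even that by (auto simp: g_def)
    ultimately have "v \<in> {1..n}"
      by blast
    moreover have "v + 1 \<notin> {4 * s, 4 * t + 1}" "v - 1 \<notin> {4 * s, 4 * t + 1}"
      using \<open>v \<in> ?P\<close> by (auto simp: f_def g_def split: if_splits; presburger)+
    ultimately show "v + 1 \<in> T - A \<or> v - 1 \<in> T - A"
      using T A(2) unfolding path_tds_iff by blast
  next
    show "0 \<notin> ?P"
      by (auto simp: f_def g_def)
  next
    fix v assume "v \<in> ?P"
    then show "v + 2 \<notin> ?P"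
      by (auto simp del: One_nat_def add_2_eq_Suc' simp: fg ff gg)
  qed (simp add: fT)
  moreover have "card (T - A) = card T - card A" "card A \<le> card T"
    using fT A(1) by (simp_all add: card_Diff_subset finite_subset card_mono)
  ultimately show ?thesis
    by linarith
qed

section \<open>Residue classes modulo 4 as building blocks\<close>

definition residue_class :: "nat \<Rightarrow> nat \<Rightarrow> nat set" where
  "residue_class n r = {x \<in> {1..n}. x mod 4 = r}"

text \<open>The least positive element of the class is \<open>(r + 3) mod 4 + 1\<close>, and the
  others follow in steps of 4. Since \<open>n + 3\<close> is at least 3, the subtraction is never
  truncated.\<close>

lemma card_residue_class:
  assumes "r < 4"
  shows "card (residue_class n r) = (n + 3 - (r + 3) mod 4) div 4"
proof (induction n)
  case 0
  show ?case
    using assms by (auto simp: residue_class_def)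
next
  case (Suc n)
  have "residue_class (Suc n) r =
      (if Suc n mod 4 = r then insert (Suc n) (residue_class n r) else residue_class n r)"
    by (auto simp: residue_class_def le_Suc_eq)
  moreover have "finite (residue_class n r)" "Suc n \<notin> residue_class n r"
    by (auto simp: residue_class_def)
  ultimately have "card (residue_class (Suc n) r) =
      (if Suc n mod 4 = r then Suc (card (residue_class n r)) else card (residue_class n r))"
    by auto
  also have "\<dots> = (Suc n + 3 - (r + 3) mod 4) div 4"
  proof -
    consider "r = 0" | "r = 1" | "r = 2" | "r = 3"
      using assms by linarith
    then show ?thesis
      unfolding Suc.IH by cases (simp; presburger)+
  qed
  finally show ?case .
qed

lemma residue_class_simps [simp]:
  "finite (residue_class n r)"
  "x \<in> residue_class n r \<longleftrightarrow> 1 \<le> x \<and> x \<le> n \<and> x mod 4 = r"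
  "r \<noteq> r' \<Longrightarrow> residue_class n r \<inter> residue_class n r' = {}"
  by (auto simp: residue_class_def)

lemma card_residue_class_Un [simp]:
  "r \<noteq> r' \<Longrightarrow> card (residue_class n r \<union> residue_class n r') =
    card (residue_class n r) + card (residue_class n r')"
  by (simp add: card_Un_disjoint)

lemma pos_mod_4_cases:
  assumes "1 \<le> v"
  obtains i :: nat where "v = 4 * i + 1" | i where "v = 4 * i + 2"
    | i where "v = 4 * i + 3" | i where "v = 4 * i + 4"
proof -
  have "v = 4 * ((v - 1) div 4) + (v - 1) mod 4 + 1" "(v - 1) mod 4 < 4"
    using assms by simp_all
  then obtain i r where v: "v = 4 * i + r + 1" and "r < 4"
    by blast
  then have "r = 0 \<or> r = 1 \<or> r = 2 \<or> r = 3"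
    by linarith
  then show thesis
    using that(1-4)[of i] v by (elim disjE) simp_all
qed

text \<open>Writing the neighbours as \<open>4 * i\<close> plus a constant removes the subtraction
  and makes membership in residue classes a matter of simplification.\<close>

lemma path_tdsI:
  assumes "S \<subseteq> {1..n}"
    and "\<And>i. 4 * i + 1 \<le> n \<Longrightarrow> 4 * i + 2 \<in> S \<or> 4 * i \<in> S"
    and "\<And>i. 4 * i + 2 \<le> n \<Longrightarrow> 4 * i + 3 \<in> S \<or> 4 * i + 1 \<in> S"
    and "\<And>i. 4 * i + 3 \<le> n \<Longrightarrow> 4 * i + 4 \<in> S \<or> 4 * i + 2 \<in> S"
    and "\<And>i. 4 * i + 4 \<le> n \<Longrightarrow> 4 * i + 5 \<in> S \<or> 4 * i + 3 \<in> S"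
  shows "path_tds n S"
proof -
  have "v + 1 \<in> S \<or> v - 1 \<in> S" if "1 \<le> v" "v \<le> n" for v
    using that(1)
  proof (cases rule: pos_mod_4_cases)
    case (1 i)
    then show ?thesis using assms(2)[of i] that(2) by simp
  next
    case (2 i)
    then show ?thesis using assms(3)[of i] that(2) by (simp add: numeral_3_eq_3)
  next
    case (3 i)
    then show ?thesis using assms(4)[of i] that(2) by (simp add: eval_nat_numeral)
  next
    case (4 i)
    then show ?thesis using assms(5)[of i] that(2) by (simp add: eval_nat_numeral)
  qed
  then show ?thesis
    using assms(1) by (simp add: path_tds_iff)
qed

lemma not_path_tdsI:
  assumes "1 \<le> v" "v \<le> n" "v + 1 \<notin> S" "v - 1 \<notin> S"
  shows "\<not> path_tds n S"
  using assms by (auto simp: path_tds_iff)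

lemma d_td_path_eqI:
  assumes "path_tds n S" "a \<in> S" "card S = m"
    and "\<not> path_tds n (S - {a})"
    and "\<And>T. path_tds n T \<Longrightarrow> a \<in> T \<Longrightarrow> m \<le> card T"
  shows "d_td (with_proj (path_graph n)) a = enat m"
  using _ assms by (rule d_td_eqI) (simp add: path_graph_def)

lemma d_td_path_minimum:
  assumes S: "path_tds n S" "a \<in> S" "card S = (n + 3) div 4 + (n + 2) div 4"
  shows "d_td (with_proj (path_graph n)) a = enat (card S)"
proof (rule d_td_path_eqI)
  \<comment> \<open>Putting both shifts at the ends of the index ranges leaves the packing
    unshifted.\<close>
  have low: "card S \<le> card T" if "path_tds n T" for T
    using that S(3) card_path_tds_ge[of n T "{}" "(n + 3) div 4" "(n + 2) div 4"
      "(n + 3) div 4" "(n + 2) div 4"] by auto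
  then show "card S \<le> card T" if "path_tds n T" for T
    using that .
  have "finite S"
    using S(1) by (meson path_tds_iff finite_atLeastAtMost finite_subset)
  then have "card (S - {a}) < card S"
    using S(2) by (rule card_Diff1_less)
  then show "\<not> path_tds n (S - {a})"
    using low[of "S - {a}"] by linarith
qed (use S in simp_all)

lemma mult_4_shift_mod_4 [simp]:
  "Suc (4 * i) mod 4 = 1" "Suc (Suc (4 * i)) mod 4 = 2"
  "0 < i \<Longrightarrow> (4 * i - Suc 0) mod 4 = 3" "0 < i \<Longrightarrow> (4 * i - Suc (Suc 0)) mod 4 = 2"
  for i :: nat
proof -
  show "Suc (4 * i) mod 4 = 1" "Suc (Suc (4 * i)) mod 4 = 2"
    by presburger+
  show "(4 * i - Suc 0) mod 4 = 3" "(4 * i - Suc (Suc 0)) mod 4 = 2" if "0 < i"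
  proof -
    obtain j where "i = Suc j"
      using \<open>0 < i\<close> by (cases i) simp_all
    then have "4 * i - Suc 0 = 4 * j + 3" "4 * i - Suc (Suc 0) = 4 * j + 2"
      by simp_all
    then show "(4 * i - Suc 0) mod 4 = 3" "(4 * i - Suc (Suc 0)) mod 4 = 2"
      by (simp_all only: mod_mult_self4) simp_all
  qed
qed

lemma mod_4_cases:
  fixes a :: nat
  shows "a mod 4 = 0 \<or> a mod 4 = 1 \<or> a mod 4 = 2 \<or> a mod 4 = 3"
  by linarith

section \<open>Values of \<open>d_td\<close> for each residue of \<open>n\<close> modulo 4\<close>

lemma d_td_path_4k2:
  assumes a: "a \<in> {1..n}" and n: "n = 4 * k + 2"
  shows "d_td (with_proj (path_graph n)) a = enat (2 * k + 2)"
proof -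
  let ?S = "residue_class n 1 \<union> residue_class n 2"
  \<comment> \<open>The classes 3 and 0 miss the only neighbours of the two end vertices, which are
    therefore added.\<close>
  let ?T = "{2, 4 * k + 1} \<union> (residue_class n 3 \<union> residue_class n 0)"
  have "path_tds n ?S"
    using n by (auto intro!: path_tdsI; presburger)
  moreover have "path_tds n ?T"
    using n by (auto intro!: path_tdsI; presburger)
  moreover have "card ?S = 2 * k + 2"
    using n by (simp add: card_residue_class)
  moreover have "card ?T = 2 * k + 2"
    using n by (simp add: card_residue_class card_insert_if)
  moreover have "a \<in> ?S \<or> a \<in> ?T"
    using a mod_4_cases[of a] by auto
  ultimately show ?thesis
    using d_td_path_minimum[of n ?S a] d_td_path_minimum[of n ?T a] n by auto
qed

lemma d_td_path_4k1:
  assumes a: "a \<in> {1..n}" and n: "n = 4 * k + 1" and k: "k > 0"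
  shows "d_td (with_proj (path_graph n)) a = enat (2 * k + 1 + of_bool (a mod 4 = 1))"
proof (cases "a mod 4 = 1")
  case True
  let ?S = "insert 2 (residue_class n 0 \<union> residue_class n 1)"
  show ?thesis
  proof (rule d_td_path_eqI)
    show "path_tds n ?S"
      using n k by (auto intro!: path_tdsI; presburger)
    show "a \<in> ?S"
      using a True by auto
    show "card ?S = 2 * k + 1 + of_bool (a mod 4 = 1)"
      using n k True by (simp add: card_residue_class card_insert_if)
    define j where "j = a div 4"
    have j: "a = 4 * j + 1"
      using True unfolding j_def by presburger
    \<comment> \<open>The vertex \<open>4 * j + 2\<close> has no neighbour in \<open>?S\<close>
      other than \<open>a\<close>. For \<open>j = k\<close> it lies beyond the path, and
      \<open>4 * j\<close> takes its place.\<close>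
    show "\<not> path_tds n (?S - {a})"
    proof (cases "j < k")
      case True
      show ?thesis
        by (rule not_path_tdsI[of "4 * j + 2"]) (use True n j in \<open>(auto; presburger)+\<close>)
    next
      case False
      then show ?thesis
        using n k j a by (intro not_path_tdsI[of "4 * j"]; simp; presburger)
    qed
    \<comment> \<open>Only the even part of the packing is shifted, at \<open>j\<close>, to skip
      \<open>a\<close>.\<close>
    show "2 * k + 1 + of_bool (a mod 4 = 1) \<le> card T" if "path_tds n T" "a \<in> T" for T
      using card_path_tds_ge[of n T "{a}" "k + 1" j "k + 1" k] that n a j True by auto
  qed
next
  case False
  let ?S = "insert (4 * k) (residue_class n 2 \<union> residue_class n 3)"
  let ?T = "insert 2 (residue_class n 3 \<union> residue_class n 0)"
  have "path_tds n ?S"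
    using n k by (auto intro!: path_tdsI; presburger)
  moreover have "path_tds n ?T"
    using n k by (auto intro!: path_tdsI; presburger)
  moreover have "card ?S = 2 * k + 1"
    using n by (simp add: card_residue_class card_insert_if)
  moreover have "card ?T = 2 * k + 1"
    using n by (simp add: card_residue_class card_insert_if)
  moreover have "a \<in> ?S \<or> a \<in> ?T"
    using a False mod_4_cases[of a] by auto
  ultimately show ?thesis
    using d_td_path_minimum[of n ?S a] d_td_path_minimum[of n ?T a] n False by auto
qed

lemma d_td_path_4k3:
  assumes a: "a \<in> {1..n}" and n: "n = 4 * k + 3" and k: "k \<noteq> 1"
  shows "d_td (with_proj (path_graph n)) a = enat (2 * k + 2 + of_bool (a mod 4 = 0))"
proof (cases "a mod 4 = 0")
  case True
  let ?S = "{2, 4 * k + 2} \<union> (residue_class n 0 \<union> residue_class n 1)"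
  define j where "j = a div 4"
  have j: "a = 4 * j" "0 < j" "j \<le> k" "1 < k"
    using a n k True unfolding j_def by auto
  show ?thesis
  proof (rule d_td_path_eqI)
    show "path_tds n ?S"
      using n k by (auto intro!: path_tdsI; presburger)
    show "a \<in> ?S"
      using a True by auto
    show "card ?S = 2 * k + 2 + of_bool (a mod 4 = 0)"
      using n j True by (simp add: card_residue_class card_insert_if)
    \<comment> \<open>For \<open>j = k\<close> the vertex \<open>4 * j + 1\<close> is dominated by
      the added \<open>4 * k + 2\<close>, so \<open>4 * k - 1\<close> is used. Its other neighbour
      \<open>4 * k - 2\<close> differs from the added 2 because \<open>k > 1\<close>; this fails for
      the path on 7 vertices.\<close>
    show "\<not> path_tds n (?S - {a})"
    proof (cases "j < k")
      case True
      show ?thesis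
        by (rule not_path_tdsI[of "4 * j + 1"]) (use True n j in \<open>(auto; presburger)+\<close>)
    next
      case False
      show ?thesis
        by (rule not_path_tdsI[of "4 * j - 1"]) (use False n j in \<open>(auto; presburger)+\<close>)
    qed
    \<comment> \<open>Here the odd part is shifted at \<open>j\<close>, and the even part stays in
      place.\<close>
    show "2 * k + 2 + of_bool (a mod 4 = 0) \<le> card T" if "path_tds n T" "a \<in> T" for T
      using card_path_tds_ge[of n T "{a}" j "k + 1" "k + 1" "k + 1"] that n a j True by auto
  qed
next
  case False
  let ?S = "residue_class n 1 \<union> residue_class n 2"
  let ?T = "residue_class n 2 \<union> residue_class n 3"
  have "path_tds n ?S"
    using n k by (auto intro!: path_tdsI; presburger)
  moreover have "path_tds n ?T"
    using n k by (auto intro!: path_tdsI; presburger)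
  moreover have "card ?S = 2 * k + 2"
    using n by (simp add: card_residue_class)
  moreover have "card ?T = 2 * k + 2"
    using n by (simp add: card_residue_class)
  moreover have "a \<in> ?S \<or> a \<in> ?T"
    using a False mod_4_cases[of a] by auto
  ultimately show ?thesis
    using d_td_path_minimum[of n ?S a] d_td_path_minimum[of n ?T a] n False by auto
qed

lemma d_td_path_4k:
  assumes a: "a \<in> {1..n}" and n: "n = 4 * k" and k: "k > 1"
  shows "d_td (with_proj (path_graph n)) a =
    enat (2 * k + of_bool (a mod 4 \<in> {0, 1}))"
proof -
  define j where "j = a div 4"
  consider "a mod 4 = 0" | "a mod 4 = 1" | "a mod 4 = 2 \<or> a mod 4 = 3"
    by linarith
  then show ?thesis
  proof cases
    case 1
    let ?S = "insert 2 (residue_class n 3 \<union> residue_class n 0)"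
    have j: "a = 4 * j" "0 < j" "j \<le> k"
      using a n 1 unfolding j_def by auto
    have "d_td (with_proj (path_graph n)) a = enat (2 * k + 1)"
    proof (rule d_td_path_eqI)
      show "path_tds n ?S"
        using n k by (auto intro!: path_tdsI; presburger)
      show "a \<in> ?S"
        using a 1 by auto
      show "card ?S = 2 * k + 1"
        using n k by (simp add: card_residue_class card_insert_if)
      \<comment> \<open>At \<open>j = k\<close> the vertex \<open>4 * k - 1\<close> depends on
        \<open>a\<close> alone, since \<open>k > 1\<close> keeps \<open>4 * k - 2\<close> apart from
        the added 2.\<close>
      show "\<not> path_tds n (?S - {a})"
      proof (cases "j < k")
        case True
        show ?thesis
          by (rule not_path_tdsI[of "4 * j + 1"]) (use True n j in \<open>(auto; presburger)+\<close>)
      next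
        case False
        show ?thesis
          by (rule not_path_tdsI[of "4 * j - 1"]) (use False n j k in \<open>(auto; presburger)+\<close>)
      qed
      show "2 * k + 1 \<le> card T" if "path_tds n T" "a \<in> T" for T
        using card_path_tds_ge[of n T "{a}" j k k k] that n j by auto
    qed
    then show ?thesis
      using 1 by simp
  next
    case 2
    \<comment> \<open>This is the mirror image, under \<open>x \<mapsto> n + 1 - x\<close>, of the
      set used for multiples of 4.\<close>
    let ?S = "insert (4 * k - 1) (residue_class n 1 \<union> residue_class n 2)"
    have j: "a = 4 * j + 1" "j < k"
      using a n 2 unfolding j_def by (auto; presburger)+
    have "d_td (with_proj (path_graph n)) a = enat (2 * k + 1)"
    proof (rule d_td_path_eqI)
      show "path_tds n ?S"
        using n k by (auto intro!: path_tdsI; presburger)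
      show "a \<in> ?S"
        using a 2 by auto
      show "card ?S = 2 * k + 1"
        using n k by (simp add: card_residue_class card_insert_if)
      show "\<not> path_tds n (?S - {a})"
      proof (cases "j = 0")
        case True
        show ?thesis
          by (rule not_path_tdsI[of 2]) (use True n j k in \<open>(auto; presburger)+\<close>)
      next
        case False
        show ?thesis
          by (rule not_path_tdsI[of "4 * j"]) (use False n j in \<open>(auto; presburger)+\<close>)
      qed
      show "2 * k + 1 \<le> card T" if "path_tds n T" "a \<in> T" for T
        using card_path_tds_ge[of n T "{a}" k j k k] that n j by auto
    qed
    then show ?thesis
      using 2 by simp
  next
    case 3
    let ?S = "residue_class n 2 \<union> residue_class n 3"
    have "path_tds n ?S"
      using n by (auto intro!: path_tdsI; presburger)
    moreover have "card ?S = 2 * k"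
      using n by (simp add: card_residue_class)
    moreover have "a \<in> ?S"
      using a 3 by auto
    ultimately show ?thesis
      using d_td_path_minimum[of n ?S a] n 3 by auto
  qed
qed

section \<open>Summation over the vertices\<close>

text \<open>In all four cases \<open>d_td\<close> is a constant, raised by 1 on certain residues
  \<open>R\<close>, so the index only requires counting the vertices in these classes.\<close>

lemma TDI_path_eq:
  assumes d_td: "\<And>a. a \<in> {1..n} \<Longrightarrow>
      d_td (with_proj (path_graph n)) a = enat (c + of_bool (a mod 4 \<in> R))"
    and R: "finite R"
  shows "TDI (with_proj (path_graph n)) = enat (n * c + (\<Sum>r\<in>R. card (residue_class n r)))"
proof -
  have "(\<Sum>a\<in>A. enat (f a)) = enat (\<Sum>a\<in>A. f a)" for f and A :: "nat set"
    by (induction A rule: infinite_finite_induct) (simp_all add: zero_enat_def)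
  then have "TDI (with_proj (path_graph n)) = enat (\<Sum>a = 1..n. c + of_bool (a mod 4 \<in> R))"
    using d_td by (simp add: TDI_def path_graph_def)
  moreover have "{1..n} \<inter> {a. a mod 4 \<in> R} = (\<Union>r\<in>R. residue_class n r)"
    by auto
  moreover have "card (\<Union>r\<in>R. residue_class n r) = (\<Sum>r\<in>R. card (residue_class n r))"
    using R by (intro card_UN_disjoint) simp_all
  ultimately show ?thesis
    by (simp add: sum.distrib sum_of_bool_eq)
qed

theorem theorem15:
  fixes n k :: nat
  assumes "n \<noteq> 4" and "n \<noteq> 7"
  shows "(n = 4 * k + 2 \<and> k \<ge> 0 \<longrightarrow>
            TDI (with_proj (path_graph n)) = enat (4 * (2 * k + 1) * (k + 1))) \<and>
         (n = 4 * k + 1 \<and> k > 0 \<longrightarrow>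
            TDI (with_proj (path_graph n)) = enat (8 * k ^ 2 + 7 * k + 2)) \<and>
         (n = 4 * k + 3 \<and> (k = 0 \<or> k > 1) \<longrightarrow>
            TDI (with_proj (path_graph n)) = enat (8 * k ^ 2 + 15 * k + 6)) \<and>
         (n = 4 * k \<and> k > 1 \<longrightarrow>
            TDI (with_proj (path_graph n)) = enat (2 * k * (4 * k + 1)))"
proof (intro conjI impI)
  assume n: "n = 4 * k + 2 \<and> k \<ge> 0"
  then have "TDI (with_proj (path_graph n)) = enat (n * (2 * k + 2))"
    using TDI_path_eq[of n "2 * k + 2" "{}"] d_td_path_4k2 by simp
  then show "TDI (with_proj (path_graph n)) = enat (4 * (2 * k + 1) * (k + 1))"
    using n by (simp add: algebra_simps)
next
  assume n: "n = 4 * k + 1 \<and> k > 0"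
  then have "TDI (with_proj (path_graph n)) = enat (n * (2 * k + 1) + card (residue_class n 1))"
    using TDI_path_eq[of n "2 * k + 1" "{1}"] d_td_path_4k1 by simp
  then show "TDI (with_proj (path_graph n)) = enat (8 * k ^ 2 + 7 * k + 2)"
    using n by (simp add: card_residue_class algebra_simps power2_eq_square)
next
  assume n: "n = 4 * k + 3 \<and> (k = 0 \<or> k > 1)"
  then have "TDI (with_proj (path_graph n)) = enat (n * (2 * k + 2) + card (residue_class n 0))"
    using TDI_path_eq[of n "2 * k + 2" "{0}"] d_td_path_4k3[of _ n k] by auto
  then show "TDI (with_proj (path_graph n)) = enat (8 * k ^ 2 + 15 * k + 6)"
    using n by (simp add: card_residue_class algebra_simps power2_eq_square)
next
  assume n: "n = 4 * k \<and> k > 1"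
  then have "TDI (with_proj (path_graph n)) =
      enat (n * (2 * k) + (card (residue_class n 0) + card (residue_class n 1)))"
    using TDI_path_eq[of n "2 * k" "{0, 1}"] d_td_path_4k by simp
  then show "TDI (with_proj (path_graph n)) = enat (2 * k * (4 * k + 1))"
    using n by (simp add: card_residue_class algebra_simps)
qed

end
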